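(* Let $(X,\cdot)$ be a nonempty compact Hausdorff left topological groupoid, and let $r(x)$, $s(x,y)$, $t(x,y,z)$ be groupoid terms in one, two and three variables respectively, where $s$ has the right-most occurrence of its last argument $y$. Suppose that for all $x,y,z\in X$: $$s(x,y)=s(x,z)=r(x)\;\Longrightarrow\; s(x,y\cdot z)=r(x),$$ and $$s(x,y)\cdot s(x,z)=s(x,t(x,y,z)).$$ Then $X$ has an idempotent, i.e. there is $e\in X$ with $e\cdot e=e$.
   Context: A groupoid is a set $X$ with a binary operation $\cdot$ (no associativity assumed). It is left topological if $X$ carries a topology such that for every fixed $a\in X$ the left translation $x\mapsto a\cdot x$ is continuous. Groupoid terms are the formal expressions built from variables by the binary operation symbol $\cdot$; a term listed with certain arguments need not actually contain all of them (e.g. $t(x,y,z)=y\cdot z$ is allowed). A term $p$ has the right-most occurrence of a variable $y$ if $y$ actually occurs in $p$ and, whenever $p_1\cdot p_2$ is a subterm of $p$ in which $y$ occurs, $y$ occurs in $p_2$ but not in $p_1$. For example, the terms $y$, $vy$, $(vv)y$, $v(vy)$, $(uv)(wy)$ have the right-most occurrence of $y$, while $yv$, $yy$, $y(vy)$, $(uy)(vy)$ do not. *)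

theory Defs
  imports "HOL-Analysis.Analysis"
begin

definition groupoid_on :: "'a set \<Rightarrow> ('a \<Rightarrow> 'a \<Rightarrow> 'a) \<Rightarrow> bool" where
  "groupoid_on X opn \<longleftrightarrow> (\<forall>a\<in>X. \<forall>b\<in>X. opn a b \<in> X)"

definition left_topological_groupoid :: "'a topology \<Rightarrow> ('a \<Rightarrow> 'a \<Rightarrow> 'a) \<Rightarrow> bool" where
  "left_topological_groupoid T opn \<longleftrightarrow>
     groupoid_on (topspace T) opn \<and> (\<forall>a\<in>topspace T. continuous_map T T (\<lambda>x. opn a x))"

datatype (vars: 'v) gterm = Var 'v | App "'v gterm" "'v gterm"

primrec subterms :: "'v gterm \<Rightarrow> 'v gterm set" where
  "subterms (Var v) = {Var v}"
| "subterms (App p q) = insert (App p q) (subterms p \<union> subterms q)"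

definition rightmost_occurrence :: "'v \<Rightarrow> 'v gterm \<Rightarrow> bool" where
  "rightmost_occurrence y p \<longleftrightarrow>
     y \<in> vars p \<and>
     (\<forall>p1 p2. App p1 p2 \<in> subterms p \<longrightarrow> y \<in> vars (App p1 p2) \<longrightarrow> y \<in> vars p2 \<and> y \<notin> vars p1)"

primrec eval_gterm :: "('a \<Rightarrow> 'a \<Rightarrow> 'a) \<Rightarrow> ('v \<Rightarrow> 'a) \<Rightarrow> 'v gterm \<Rightarrow> 'a" where
  "eval_gterm opn \<sigma> (Var v) = \<sigma> v"
| "eval_gterm opn \<sigma> (App p q) = opn (eval_gterm opn \<sigma> p) (eval_gterm opn \<sigma> q)"

text \<open>A term in \<open>n\<close> variables is a term over the variables \<open>0, \<dots>, n - 1\<close>, standing for the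
  first, ..., last argument. It need not contain all of them.\<close>

definition term_in :: "nat \<Rightarrow> nat gterm \<Rightarrow> bool" where
  "term_in n p \<longleftrightarrow> vars p \<subseteq> {..<n}"

text \<open>The value of \<open>p\<close> at a list of arguments; meaningful for \<open>term_in (length as) p\<close>.\<close>

definition term_app :: "('a \<Rightarrow> 'a \<Rightarrow> 'a) \<Rightarrow> nat gterm \<Rightarrow> 'a list \<Rightarrow> 'a" where
  "term_app opn p as = eval_gterm opn (\<lambda>i. as ! i) p"

end

theory Submission
  imports Defs
begin

text \<open>
  The argument follows the classical proof of the Ellis--Numakura lemma. By compactness and Zorn's
  lemma there is a minimal nonempty closed subgroupoid \<open>M\<close>; the two hypotheses on terms force \<open>M\<close> to
  be a single point, which is then an idempotent.

  Fix \<open>x \<in> M\<close>. Although only left translations are continuous, the map \<open>y \<mapsto> s(x, y)\<close> is continuous: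
  when \<open>y\<close> is right-most in \<open>s\<close>, this map is a composition of left translations
  (\<open>continuous_map_eval_rightmost\<close>). Hence \<open>s(x, M)\<close> is compact, so closed. The second hypothesis
  makes it a subgroupoid, and minimality gives \<open>s(x, M) = M\<close>. As \<open>r(x) \<in> M\<close>, the closed set
  \<open>{y \<in> M. s(x, y) = r(x)}\<close> is nonempty. By the first hypothesis it is a subgroupoid, so it is all
  of \<open>M\<close> too. Consequently \<open>M = s(x, M) = {r(x)}\<close>.
\<close>

lemma eval_gterm_in:
  assumes "groupoid_on M opn" and "\<And>v. v \<in> vars p \<Longrightarrow> \<sigma> v \<in> M"
  shows "eval_gterm opn \<sigma> p \<in> M"
  using assms(2) by (induction p) (use assms(1) in \<open>auto simp: groupoid_on_def\<close>)

lemma eval_gterm_cong: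
  "(\<And>v. v \<in> vars p \<Longrightarrow> \<sigma> v = \<tau> v) \<Longrightarrow> eval_gterm opn \<sigma> p = eval_gterm opn \<tau> p"
  by (induction p) auto

lemma term_app_in:
  assumes "groupoid_on M opn" and "term_in n p" and "length as = n" and "set as \<subseteq> M"
  shows "term_app opn p as \<in> M"
  unfolding term_app_def
  using assms by (intro eval_gterm_in) (auto simp: term_in_def subset_iff)

lemma subterms_self: "p \<in> subterms p"
  by (cases p) auto

text \<open>Descending into the right factor of a product is what allows an induction in which the left
  factor is a constant.\<close>

lemma rightmost_occurrence_AppD:
  assumes "rightmost_occurrence y (App p q)"
  shows "y \<notin> vars p" and "rightmost_occurrence y q"
  using assms subterms_self[of q] by (auto simp: rightmost_occurrence_def)

text \<open>A term with right-most \<open>y\<close> has the form \<open>a\<^sub>1 (a\<^sub>2 (\<dots> (a\<^sub>k y)))\<close> with no \<open>y\<close> in the \<open>a\<^sub>i\<close>, so as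
  a function of \<open>y\<close> it is a composition of left translations.\<close>

lemma continuous_map_eval_rightmost:
  assumes T: "left_topological_groupoid T opn"
    and "rightmost_occurrence y p"
    and "\<And>v. v \<in> vars p \<Longrightarrow> v \<noteq> y \<Longrightarrow> \<sigma> v \<in> topspace T"
  shows "continuous_map T T (\<lambda>a. eval_gterm opn (\<sigma>(y := a)) p)"
  using assms(2,3)
proof (induction p)
  case (Var v)
  then show ?case by (simp add: rightmost_occurrence_def)
next
  case (App p q)
  note y = rightmost_occurrence_AppD[OF App.prems(1)]
  have cont_q: "continuous_map T T (\<lambda>a. eval_gterm opn (\<sigma>(y := a)) q)"
    by (rule App.IH(2)[OF y(2)]) (simp add: App.prems(2))
  have p_const: "eval_gterm opn (\<sigma>(y := a)) p = eval_gterm opn \<sigma> p" for a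
    by (rule eval_gterm_cong) (use y(1) in auto)
  have "eval_gterm opn \<sigma> p \<in> topspace T"
    by (rule eval_gterm_in) (use T App.prems(2) y(1) in \<open>auto simp: left_topological_groupoid_def\<close>)
  then have "continuous_map T T (opn (eval_gterm opn \<sigma> p))"
    using T by (simp add: left_topological_groupoid_def)
  from continuous_map_compose[OF cont_q this] show ?case
    by (simp only: p_const o_def eval_gterm.simps)
qed

lemma continuous_map_term_app_rightmost:
  assumes "left_topological_groupoid T opn" and "term_in 2 s" and "rightmost_occurrence 1 s"
    and "x \<in> topspace T"
  shows "continuous_map T T (\<lambda>y. term_app opn s [x, y])"
proof -
  have "term_app opn s [x, y] = eval_gterm opn ((\<lambda>_. x)(1 := y)) s" for y
    unfolding term_app_def
    by (rule eval_gterm_cong) (use assms(2) in \<open>auto simp: term_in_def nth_Cons split: nat.split\<close>)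
  then show ?thesis
    using continuous_map_eval_rightmost[OF assms(1,3), of "\<lambda>_. x"] assms(4) by simp
qed

definition closed_subgroupoid :: "'a topology \<Rightarrow> ('a \<Rightarrow> 'a \<Rightarrow> 'a) \<Rightarrow> 'a set \<Rightarrow> bool" where
  "closed_subgroupoid T opn M \<longleftrightarrow> closedin T M \<and> M \<noteq> {} \<and> groupoid_on M opn"

text \<open>Compactness enters here: it keeps the intersection of a chain of nonempty closed
  subgroupoids nonempty, so that Zorn's lemma applies to reverse inclusion.\<close>

lemma minimal_closed_subgroupoid:
  assumes "compact_space T" and "closed_subgroupoid T opn A"
  obtains M where "closed_subgroupoid T opn M"
    and "\<And>N. closed_subgroupoid T opn N \<Longrightarrow> N \<subseteq> M \<Longrightarrow> N = M"
proof -
  let ?S = "{M. closed_subgroupoid T opn M}"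
  have po: "partial_order_on ?S (relation_of (\<lambda>a b. b \<subseteq> a) ?S)"
    by (rule partial_order_on_relation_ofI) auto
  have "\<exists>u\<in>?S. \<forall>a\<in>C. u \<subseteq> a" if C: "C \<in> Chains (relation_of (\<lambda>a b. b \<subseteq> a) ?S)" for C
  proof (cases "C = {}")
    case True
    then show ?thesis using assms(2) by auto
  next
    case False
    have mem: "closed_subgroupoid T opn a" if "a \<in> C" for a
      using C that by (auto simp: Chains_def relation_of_def)
    have lin: "a \<subseteq> b \<or> b \<subseteq> a" if "a \<in> C" "b \<in> C" for a b
      using C that by (auto simp: Chains_def relation_of_def)
    have fip: "\<Inter>F \<noteq> {}" if F: "finite F" "F \<subseteq> C" for F
    proof (cases "F = {}")
      case False
      have "subset.chain UNIV F"
        using F(2) lin by (auto simp: subset_chain_def)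
      then have "\<Inter>F \<in> F"
        using Inter_in_chain[OF F(1) False] by blast
      then show ?thesis
        using mem F(2) by (auto simp: closed_subgroupoid_def)
    qed simp
    have "\<Inter>C \<noteq> {}"
      using assms(1) mem fip unfolding compact_space_fip closed_subgroupoid_def by blast
    moreover have "closedin T (\<Inter>C)"
      using False mem by (intro closedin_Inter) (auto simp: closed_subgroupoid_def)
    moreover have "groupoid_on (\<Inter>C) opn"
      using mem by (auto simp: closed_subgroupoid_def groupoid_on_def)
    ultimately show ?thesis
      by (auto simp: closed_subgroupoid_def)
  qed
  from predicate_Zorn[OF po this] show ?thesis
    using that by auto
qed

theorem mainTheorem5:
  fixes T :: "'a topology"
    and opn :: "'a \<Rightarrow> 'a \<Rightarrow> 'a"
    and r s t :: "nat gterm"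
  assumes "topspace T \<noteq> {}"
    and "compact_space T"
    and "Hausdorff_space T"
    and "left_topological_groupoid T opn"
    and "term_in 1 r"
    and "term_in 2 s"
    and "term_in 3 t"
    and "rightmost_occurrence 1 s"
    and "\<And>x y z. \<lbrakk>x \<in> topspace T; y \<in> topspace T; z \<in> topspace T;
           term_app opn s [x, y] = term_app opn r [x]; term_app opn s [x, z] = term_app opn r [x]\<rbrakk>
         \<Longrightarrow> term_app opn s [x, opn y z] = term_app opn r [x]"
    and "\<And>x y z. \<lbrakk>x \<in> topspace T; y \<in> topspace T; z \<in> topspace T\<rbrakk>
         \<Longrightarrow> opn (term_app opn s [x, y]) (term_app opn s [x, z])
             = term_app opn s [x, term_app opn t [x, y, z]]"
  shows "\<exists>e\<in>topspace T. opn e e = e"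
proof -
  let ?s = "\<lambda>x y. term_app opn s [x, y]"
  have "closed_subgroupoid T opn (topspace T)"
    using assms(1,4) by (simp add: closed_subgroupoid_def left_topological_groupoid_def)
  with assms(2) obtain M where M: "closed_subgroupoid T opn M"
    and minimal: "\<And>N. closed_subgroupoid T opn N \<Longrightarrow> N \<subseteq> M \<Longrightarrow> N = M"
    using minimal_closed_subgroupoid by metis
  have closed: "closedin T M" and grp: "groupoid_on M opn" and "M \<noteq> {}"
    using M by (auto simp: closed_subgroupoid_def)
  have MT: "a \<in> topspace T" if "a \<in> M" for a
    using closedin_subset[OF closed] that by blast
  obtain x where x: "x \<in> M"
    using \<open>M \<noteq> {}\<close> by blast
  define c where "c = term_app opn r [x]"
  have c: "c \<in> M"
    unfolding c_def by (rule term_app_in[OF grp assms(5)]) (use x in auto)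
  have sM: "?s x y \<in> M" if "y \<in> M" for y
    by (rule term_app_in[OF grp assms(6)]) (use x that in auto)
  have tM: "term_app opn t [x, y, z] \<in> M" if "y \<in> M" "z \<in> M" for y z
    by (rule term_app_in[OF grp assms(7)]) (use x that in auto)
  have cont: "continuous_map T T (?s x)"
    using assms(4,6,8) MT[OF x] by (rule continuous_map_term_app_rightmost)

  have image: "?s x ` M = M"
  proof (rule minimal)
    have "closedin T (?s x ` M)"
      using closedin_compact_space[OF assms(2) closed] cont assms(3)
      by (intro compactin_imp_closedin image_compactin)
    moreover have "groupoid_on (?s x ` M) opn"
      unfolding groupoid_on_def using assms(10) tM MT x by auto
    ultimately show "closed_subgroupoid T opn (?s x ` M)"
      using x by (auto simp: closed_subgroupoid_def)
  qed (use sM in auto)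

  have fibre: "{y \<in> M. ?s x y = c} = M"
  proof (rule minimal)
    have "closedin T {y \<in> topspace T. ?s x y \<in> {c}}"
      using cont by (rule closedin_continuous_map_preimage)
        (simp add: closedin_Hausdorff_singleton assms(3) MT c)
    then have "closedin T (M \<inter> {y \<in> topspace T. ?s x y \<in> {c}})"
      using closed by (intro closedin_Int)
    moreover have "M \<inter> {y \<in> topspace T. ?s x y \<in> {c}} = {y \<in> M. ?s x y = c}"
      using MT by auto
    moreover have "c \<in> ?s x ` M"
      using c image by simp
    then have "{y \<in> M. ?s x y = c} \<noteq> {}"
      by blast
    moreover have "groupoid_on {y \<in> M. ?s x y = c} opn"
      using grp assms(9)[OF MT[OF x] MT MT] by (auto simp: groupoid_on_def c_def)
    ultimately show "closed_subgroupoid T opn {y \<in> M. ?s x y = c}"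
      by (simp add: closed_subgroupoid_def)
  qed auto

  have "M = {c}"
    using image fibre c by auto
  then have "opn c c = c"
    using grp by (simp add: groupoid_on_def)
  then show ?thesis
    using MT[OF c] by blast
qed

end
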